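(* Let $d>0$ be fixed and let $G_n=\mathcal{G}(n,\frac dn)$. For a positive integer $\ell$, let $F_\ell$ be the event that $G_n$ contains a triangle-induced subgraph spanned by $\ell$ triangles. Let $\mu>0$ be a constant. Then for any constant $\eta>0$, for all sufficiently large $n$ and any integer $\ell$ with $1\le\ell\le n^{\frac1{10}-\mu}$, $$\mathbb{P}(F_\ell)\le\Big(\frac1n\Big)^{(1-\eta)h(\ell)}.$$
   Context: $\mathcal{G}(n,p)$ is the Erdős–Rényi random graph on $n$ vertices with independent edges of probability $p$ (here $n$ is large enough that $d/n\le 1$). A graph $G=(V,E)$ is called triangle-induced if it is connected and can be obtained by taking a union of triangles. A triangle-induced graph $G=(V,E)$ is said to be spanned by $\ell$ triangles if there exist distinct triangles $T_1,\dots,T_\ell$ such that $V=\bigcup_iV(T_i)$ and $E=\bigcup_iE(T_i)$ (the graph may contain further triangles). A triangle-induced subgraph of $G_n$ is a (not necessarily induced) subgraph which is a triangle-induced graph. The function $h:\mathbb{R}\to[0,\infty)$ is defined as follows. Let $f(x)=\frac{\sqrt2}{3}(x+1)^{3/2}+3(x+1)$ for $x\ge0$, which is strictly increasing with $f(1)<10$. For $y>10$, $h(y)$ is the unique $x$ with $f(x)=y$ (so $h(y)>1$); for $2\le y\le10$, $h(y)=1$; for $y<2$, $h(y)=0$. *)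

theory Defs
  imports "HOL-Probability.Probability" "HOL-Library.Ramsey"
begin

section \<open>Graphs\<close>

text \<open>A graph is a pair of a vertex set and a set of edges, an edge being a two-element set of
  vertices; \<open>[V]\<^bsup>2\<^esup>\<close> is the set of all two-element subsets of \<open>V\<close>.\<close>

type_synonym 'a graph = "'a set \<times> 'a set set"

abbreviation verts :: "'a graph \<Rightarrow> 'a set" where "verts \<equiv> fst"
abbreviation edges :: "'a graph \<Rightarrow> 'a set set" where "edges \<equiv> snd"

definition simple_graph :: "'a graph \<Rightarrow> bool" where
  "simple_graph G \<longleftrightarrow> finite (verts G) \<and> edges G \<subseteq> [verts G]\<^bsup>2\<^esup>"

definition subgraph :: "'a graph \<Rightarrow> 'a graph \<Rightarrow> bool" where
  "subgraph H G \<longleftrightarrow> simple_graph H \<and> verts H \<subseteq> verts G \<and> edges H \<subseteq> edges G"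

definition connected_graph :: "'a graph \<Rightarrow> bool" where
  "connected_graph G \<longleftrightarrow> verts G \<noteq> {} \<and>
     (\<forall>u\<in>verts G. \<forall>v\<in>verts G. (u, v) \<in> {(x, y). {x, y} \<in> edges G}\<^sup>*)"

definition triangle :: "'a graph \<Rightarrow> bool" where
  "triangle T \<longleftrightarrow> card (verts T) = 3 \<and> edges T = [verts T]\<^bsup>2\<^esup>"

definition union_graph :: "'a graph set \<Rightarrow> 'a graph" where
  "union_graph \<T> = (\<Union> (verts ` \<T>), \<Union> (edges ` \<T>))"

definition triangle_induced :: "'a graph \<Rightarrow> bool" where
  "triangle_induced G \<longleftrightarrow> simple_graph G \<and> connected_graph G \<and>
     (\<exists>\<T>. (\<forall>T\<in>\<T>. triangle T) \<and> G = union_graph \<T>)"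

text \<open>The \<open>l\<close> distinct triangles form a set of cardinality \<open>l\<close>; \<open>G\<close> may have
  further triangles.\<close>

definition spanned_by_triangles :: "'a graph \<Rightarrow> nat \<Rightarrow> bool" where
  "spanned_by_triangles G l \<longleftrightarrow>
     (\<exists>\<T>. finite \<T> \<and> card \<T> = l \<and> (\<forall>T\<in>\<T>. triangle T) \<and> G = union_graph \<T>)"


section \<open>The Erdos--Renyi random graph\<close>

text \<open>The distribution on graphs with vertex set \<open>{0..<n}\<close> in which each pair is an edge
  independently with probability \<open>p\<close>. It is meaningful for \<open>0 \<le> p \<le> 1\<close>;
  \<^const>\<open>bernoulli_pmf\<close> clips other values of \<open>p\<close> to this interval.\<close>

definition gnp :: "nat \<Rightarrow> real \<Rightarrow> nat graph pmf" where
  "gnp n p = map_pmf (\<lambda>X. ({0..<n}, {e \<in> [{0..<n}]\<^bsup>2\<^esup>. X e}))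
     (Pi_pmf ([{0..<n}]\<^bsup>2\<^esup>) False (\<lambda>_. bernoulli_pmf p))"

definition F_event :: "nat \<Rightarrow> 'a graph set" where
  "F_event l = {G. \<exists>H. subgraph H G \<and> triangle_induced H \<and> spanned_by_triangles H l}"


section \<open>The exponent function\<close>

definition f_exc :: "real \<Rightarrow> real" where
  "f_exc x = sqrt 2 / 3 * (x + 1) powr (3 / 2) + 3 * (x + 1)"

definition h_exc :: "real \<Rightarrow> real" where
  "h_exc y = (if y > 10 then (THE x. x \<ge> 0 \<and> f_exc x = y) else if y \<ge> 2 then 1 else 0)"

text \<open>The definite description above is well defined:\<close>

lemma f_exc_strict_mono: "strict_mono_on {0..} f_exc"
proof (rule strict_mono_onI)
  fix r s :: real assume "r \<in> {0..}" "s \<in> {0..}" "r < s"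
  then have "sqrt 2 / 3 * (r + 1) powr (3 / 2) < sqrt 2 / 3 * (s + 1) powr (3 / 2)"
    by (intro mult_strict_left_mono powr_less_mono2) auto
  then show "f_exc r < f_exc s"
    unfolding f_exc_def using \<open>r < s\<close> by (intro add_strict_mono) auto
qed

lemma f_exc_ex1:
  assumes "y > 10"
  shows "\<exists>!x. x \<ge> 0 \<and> f_exc x = y"
proof -
  have "continuous_on {0..y} f_exc"
    unfolding f_exc_def by (intro continuous_intros) auto
  moreover have "f_exc 0 \<le> y"
    using assms sqrt2_less_2 by (simp add: f_exc_def)
  moreover have "0 + y \<le> f_exc y"
    using assms unfolding f_exc_def by (intro add_mono) auto
  ultimately obtain x where "0 \<le> x" "f_exc x = y"
    using IVT'[of f_exc 0 y y] assms by auto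
  then show ?thesis
    using strict_mono_on_imp_inj_on[OF f_exc_strict_mono] by (auto simp: inj_on_def)
qed

lemma h_exc_eqI: "y > 10 \<Longrightarrow> x \<ge> 0 \<Longrightarrow> f_exc x = y \<Longrightarrow> h_exc y = x"
  using f_exc_ex1[of y] by (auto simp: h_exc_def intro!: the1_equality)

end

theory Submission
  imports Defs
begin

text \<open>Call \<open>e - v\<close> the excess of a graph with \<open>v\<close> vertices and \<open>e\<close> edges. The expected
  number of copies of a fixed graph of excess \<open>k\<close> in \<open>G(n, d/n)\<close> is of order \<open>n\<^sup>-\<^sup>k\<close>, so the exponent
  \<open>h(l)\<close> must be a lower bound for the excess of a triangle-induced graph spanned by \<open>l\<close> triangles,
  and the union over all such graphs must cost only a factor \<open>n\<close> to the power \<open>\<eta> h(l)\<close>.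

  The bound on the excess (\<open>h_exc_le_excess\<close>). Remove a breadth-first spanning tree; the \<open>c = e - v + 1\<close>
  remaining edges are the cotree. A triangle inside the cotree is one of at most
  \<open>sqrt 2 / 3 * c powr (3/2)\<close> (\<open>card_triangles_le\<close>), and any other triangle consists of a cotree edge
  \<open>{v, w}\<close> together with the parent of \<open>v\<close>, so there are at most \<open>2 c\<close> of these
  (\<open>card_triangles_cotree\<close>). For \<open>l > 10\<close> it follows that \<open>l\<close> is at most \<open>f (c - 1)\<close>, that is, the excess \<open>c - 1\<close> is at least
  \<open>h(l)\<close>. Since every vertex other than the root meets a cotree edge (\<open>card_verts_cotree\<close>), the graph
  also has at most \<open>3 c\<close> edges.

  The union bound (\<open>prob_gnp_contains_some_le\<close>). If \<open>h = h(l)\<close> is bounded, only boundedly many vertices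
  occur and a first moment computation suffices. If \<open>h\<close> is large, two cases arise. When the excess is
  at least \<open>5 h\<close>, even the crude count of \<open>v\<^sup>2\<^sup>e\<close> graphs per vertex set is harmless: \<open>v\<^sup>2\<close> is below
  \<open>n powr (1/5)\<close> up to a constant and \<open>e\<close> is at most three times the excess plus three, so more than
  \<open>h\<close> of the exponent survives (\<open>prob_sparse_le\<close>). When the excess is less than \<open>5 h\<close>, the number of
  edges is of order \<open>h\<close>, and the number of triangles is of the largest order that this permits. Then one
  passes to the subgraph spanned by the edges that lie in many triangles (\<open>dense_core\<close>). It loses few
  triangles, so it still has nearly \<open>h\<close> edges, but it has only of order \<open>sqrt h\<close> vertices
  (\<open>dense_subgraph_of_spanned\<close>). Its excess is therefore at least \<open>(1 - \<eta>/2) h\<close>, and there are only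
  \<open>exp (O(h))\<close> graphs on a vertex set of this size (\<open>prob_dense_le\<close>).\<close>

section \<open>Triangles in a graph with few edges\<close>

text \<open>A triangle is determined by its three vertices and is therefore encoded as its vertex set.\<close>

definition triangles :: "'a set set \<Rightarrow> 'a set set" where
  "triangles E = {T. card T = 3 \<and> [T]\<^bsup>2\<^esup> \<subseteq> E}"

definition arcs :: "'a set set \<Rightarrow> ('a \<times> 'a) set" where
  "arcs E = {(x, y). {x, y} \<in> E}"

abbreviation neighbours :: "'a set set \<Rightarrow> 'a \<Rightarrow> 'a set" where
  "neighbours E x \<equiv> {y. {x, y} \<in> E}"

lemma triangles_iff:
  "T \<in> triangles E \<longleftrightarrow> (\<exists>x y z. T = {x, y, z} \<and> x \<noteq> y \<and> y \<noteq> z \<and> x \<noteq> z \<and>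
     {x, y} \<in> E \<and> {y, z} \<in> E \<and> {x, z} \<in> E)" (is "?L \<longleftrightarrow> ?R")
proof
  assume ?L
  then obtain x y z where "T = {x, y, z}" "x \<noteq> y" "y \<noteq> z" "x \<noteq> z" and sub: "[T]\<^bsup>2\<^esup> \<subseteq> E"
    by (auto simp: triangles_def card_3_iff)
  moreover from this have "{x, y} \<in> [T]\<^bsup>2\<^esup>" "{y, z} \<in> [T]\<^bsup>2\<^esup>" "{x, z} \<in> [T]\<^bsup>2\<^esup>"
    by (auto simp: nsets_def)
  ultimately show ?R using sub by blast
next
  assume ?R
  then obtain x y z where T: "T = {x, y, z}" "x \<noteq> y" "y \<noteq> z" "x \<noteq> z"
    and E: "{x, y} \<in> E" "{y, z} \<in> E" "{x, z} \<in> E"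
    by blast
  have "e \<in> E" if e: "e \<in> [T]\<^bsup>2\<^esup>" for e
  proof -
    obtain a b where "e = {a, b}" "a \<noteq> b" "a \<in> T" "b \<in> T"
      using e by (auto simp: nsets_def card_2_iff)
    then show ?thesis using T E by (auto simp: insert_commute)
  qed
  then show ?L using T by (auto simp: triangles_def)
qed

lemma triangles_subset_Pow: "triangles E \<subseteq> Pow (\<Union> E)"
proof
  fix T assume "T \<in> triangles E"
  then obtain x y z where "T = {x, y, z}" "{x, y} \<in> E" "{y, z} \<in> E"
    unfolding triangles_iff by blast
  then show "T \<in> Pow (\<Union> E)" by auto
qed

locale edge_set =
  fixes E :: "'a set set"
  assumes fin: "finite E" and two: "\<And>e. e \<in> E \<Longrightarrow> card e = 2"
begin

lemma finite_verts: "finite (\<Union> E)"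
proof (rule finite_Union[OF fin])
  show "finite e" if e: "e \<in> E" for e using two[OF e] by (intro card_ge_0_finite) simp
qed

lemma finite_triangles: "finite (triangles E)"
  by (rule finite_subset[OF triangles_subset_Pow]) (simp add: finite_verts)

lemma loopfree: "{x, y} \<in> E \<Longrightarrow> x \<noteq> y"
  using two by force

lemma subset: "F \<subseteq> E \<Longrightarrow> edge_set F"
  using fin two by unfold_locales (auto dest: finite_subset)

lemma finite_neighbours: "finite (neighbours E x)"
  by (rule finite_subset[OF _ finite_verts]) auto

lemma finite_arcs: "finite (arcs E)"
  by (rule finite_subset[of _ "\<Union>E \<times> \<Union>E"]) (auto simp: arcs_def finite_verts)

lemma arcs_eq_Sigma: "arcs E = Sigma (\<Union>E) (neighbours E)"
  by (auto simp: arcs_def)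

lemma card_arcs: "card (arcs E) = (\<Sum>x\<in>\<Union>E. card (neighbours E x))"
  unfolding arcs_eq_Sigma by (simp add: finite_verts finite_neighbours)

lemma card_arcs_le: "card (arcs E) \<le> 2 * card E"
proof -
  have "arcs E \<subseteq> (\<Union>e\<in>E. {(x, y). {x, y} = e})"
    by (auto simp: arcs_def)
  moreover have two_arcs: "card {(x, y). {x, y} = e} \<le> 2 \<and> finite {(x, y). {x, y} = e}" if e: "e \<in> E" for e
  proof -
    obtain a b where ab: "e = {a, b}" "a \<noteq> b" using two[OF e] by (auto simp: card_2_iff)
    have "{(x, y). {x, y} = e} = {(a, b), (b, a)}"
      unfolding ab(1) by (auto simp: doubleton_eq_iff)
    then show ?thesis using ab(2) by simp
  qed
  ultimately have "card (arcs E) \<le> card (\<Union>e\<in>E. {(x, y). {x, y} = e})"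
    using fin by (intro card_mono) auto
  also have "\<dots> \<le> (\<Sum>e\<in>E. card {(x, y). {x, y} = e})"
    by (rule card_UN_le[OF fin])
  also have "\<dots> \<le> (\<Sum>e\<in>E. 2)"
    using two_arcs by (intro sum_mono) auto
  finally show ?thesis by simp
qed

text \<open>Write \<open>c(x, y)\<close> for the number of common neighbours of \<open>x\<close> and \<open>y\<close>, so that the set of triples has
  \<open>\<Sum> c(x, y)\<close> elements, the sum ranging over the arcs. By Cauchy-Schwarz its square is at most the
  number of arcs times \<open>\<Sum> c(x, y)\<^sup>2\<close>. Here \<open>c(x, y)\<close> is at most each of the degrees of \<open>x\<close> and \<open>y\<close>, so
  \<open>c(x, y)\<^sup>2\<close> is at most their product, and summing this product over all pairs of vertices gives the
  square of the number of arcs.\<close>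

lemma card_triples_square:
  defines "Q \<equiv> SIGMA a:arcs E. neighbours E (fst a) \<inter> neighbours E (snd a)"
  shows "(card Q)\<^sup>2 \<le> (card (arcs E))^3"
proof -
  let ?d = "\<lambda>x. card (neighbours E x)"
  let ?c = "\<lambda>a. card (neighbours E (fst a) \<inter> neighbours E (snd a))"
  have cd: "(?c a)\<^sup>2 \<le> ?d (fst a) * ?d (snd a)" for a
    unfolding power2_eq_square
    by (intro mult_mono card_mono finite_neighbours) auto
  have "card Q = (\<Sum>a\<in>arcs E. ?c a)"
    unfolding Q_def by (simp add: finite_arcs finite_neighbours)
  then have "real ((card Q)\<^sup>2) = (\<Sum>a\<in>arcs E. 1 * real (?c a))\<^sup>2" by simp
  also have "\<dots> \<le> (\<Sum>a\<in>arcs E. 1\<^sup>2) * (\<Sum>a\<in>arcs E. (real (?c a))\<^sup>2)"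
    by (rule Cauchy_Schwarz_ineq_sum)
  also have "\<dots> = real (card (arcs E) * (\<Sum>a\<in>arcs E. (?c a)\<^sup>2))" by simp
  also have "\<dots> \<le> real (card (arcs E) * (\<Sum>a\<in>\<Union>E \<times> \<Union>E. ?d (fst a) * ?d (snd a)))"
    unfolding of_nat_le_iff
  proof (intro mult_left_mono)
    have "(\<Sum>a\<in>arcs E. (?c a)\<^sup>2) \<le> (\<Sum>a\<in>arcs E. ?d (fst a) * ?d (snd a))"
      by (rule sum_mono) (rule cd)
    also have "\<dots> \<le> (\<Sum>a\<in>\<Union>E \<times> \<Union>E. ?d (fst a) * ?d (snd a))"
      by (rule sum_mono2) (auto simp: finite_verts arcs_def)
    finally show "(\<Sum>a\<in>arcs E. (?c a)\<^sup>2) \<le> \<dots>" .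
  qed auto
  also have "(\<Sum>a\<in>\<Union>E \<times> \<Union>E. ?d (fst a) * ?d (snd a)) = (card (arcs E))\<^sup>2"
    unfolding card_arcs power2_eq_square sum_product sum.cartesian_product
    by (simp add: case_prod_unfold)
  finally show ?thesis
    unfolding of_nat_le_iff by (simp add: power2_eq_square power3_eq_cube)
qed

text \<open>Each triangle gives rise to the six orderings of its vertices.\<close>

lemma six_triangles_le_triples:
  "6 * card (triangles E)
     \<le> card (SIGMA a:arcs E. neighbours E (fst a) \<inter> neighbours E (snd a))" (is "_ \<le> card ?Q")
proof -
  let ?S = "\<lambda>T. {((x, y), z) | x y z. {x, y, z} = T}"
  have S: "card (?S T) \<ge> 6 \<and> finite (?S T) \<and> ?S T \<subseteq> ?Q" if T: "T \<in> triangles E" for T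
  proof -
    obtain x y z where T: "T = {x, y, z}" "x \<noteq> y" "y \<noteq> z" "x \<noteq> z"
      and E: "{x, y} \<in> E" "{y, z} \<in> E" "{x, z} \<in> E"
      using T unfolding triangles_iff by blast
    let ?X = "{((x,y),z), ((x,z),y), ((y,x),z), ((y,z),x), ((z,x),y), ((z,y),x)}"
    have eq: "?S T = ?X"
    proof
      show "?X \<subseteq> ?S T" unfolding T by auto
      show "?S T \<subseteq> ?X"
      proof
        fix q assume "q \<in> ?S T"
        then obtain a b c where q: "q = ((a, b), c)" and abc: "{a, b, c} = T" by blast
        have "card {a, b, c} = 3" unfolding abc T(1) using T by simp
        then have ne: "a \<noteq> b" "b \<noteq> c" "a \<noteq> c" by (auto simp: card_insert_if split: if_splits)
        have "a \<in> {x, y, z}" "b \<in> {x, y, z}" "c \<in> {x, y, z}"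
          using abc unfolding T(1) by blast+
        then show "q \<in> ?X" using ne unfolding q by (elim insertE) simp_all
      qed
    qed
    have "?X \<subseteq> ?Q" using E by (auto simp: arcs_def insert_commute)
    moreover have "card ?X = 6" using T by simp
    ultimately show ?thesis unfolding eq by simp
  qed
  have "6 * card (triangles E) = (\<Sum>T\<in>triangles E. 6)" by simp
  also have "\<dots> \<le> (\<Sum>T\<in>triangles E. card (?S T))" using S by (intro sum_mono) auto
  also have "\<dots> = card (\<Union>T\<in>triangles E. ?S T)"
    using S by (intro card_UN_disjoint[symmetric] finite_triangles) auto
  also have "\<dots> \<le> card ?Q"
  proof (rule card_mono)
    show "finite ?Q" by (intro finite_SigmaI finite_arcs) (simp add: finite_neighbours)
    show "(\<Union>T\<in>triangles E. ?S T) \<subseteq> ?Q" using S by (intro UN_least) blast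
  qed
  finally show ?thesis .
qed

text \<open>The asymptotic Kruskal-Katona bound: with \<open>t\<close> triangles and \<open>m\<close> edges the previous two lemmas
  give \<open>(6 t)\<^sup>2 \<le> (2 m)\<^sup>3\<close>.\<close>

lemma card_triangles_le:
  "real (card (triangles E)) \<le> sqrt 2 / 3 * real (card E) powr (3/2)"
proof -
  let ?t = "card (triangles E)" and ?e = "card E"
  have "(6 * ?t)\<^sup>2 \<le> (card (arcs E))^3"
    using card_triples_square power_mono[OF six_triangles_le_triples, of 2] by simp
  also have "\<dots> \<le> (2 * ?e)^3" by (intro power_mono card_arcs_le) auto
  finally have "real ((6 * ?t)\<^sup>2) \<le> real ((2 * ?e)^3)" unfolding of_nat_le_iff .
  then have le: "(real ?t)\<^sup>2 \<le> 2 / 9 * real ?e ^ 3" by (simp add: power_mult_distrib)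
  have "(sqrt 2 / 3 * real ?e powr (3/2))\<^sup>2 = 2 / 9 * (real ?e powr (3/2))\<^sup>2"
    by (simp add: power_mult_distrib power_divide)
  also have "(real ?e powr (3/2))\<^sup>2 = real ?e ^ 3"
    unfolding power2_eq_square powr_add[symmetric] by simp
  finally have "(real ?t)\<^sup>2 \<le> (sqrt 2 / 3 * real ?e powr (3/2))\<^sup>2" using le by linarith
  then show ?thesis by (rule power2_le_imp_le) simp
qed

text \<open>Among all sets of edges take one that maximises the number of triangles minus \<open>s\<close> times the number
  of edges. Removing a single edge does not increase this quantity, so each remaining edge lies in at
  least \<open>s\<close> triangles and each vertex that it covers has degree at least \<open>s\<close>. Comparison with the
  whole graph shows how many triangles are lost.\<close>

lemma dense_core:
  fixes s :: real
  assumes s: "s \<ge> 0"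
  obtains F where "F \<subseteq> E" "real (card (triangles E)) \<le> real (card (triangles F)) + s * real (card E)"
    "real (card (\<Union>F)) * s \<le> 2 * real (card E)"
proof -
  define w where "w F = real (card (triangles F)) - s * real (card F)" for F :: "'a set set"
  obtain F where F: "F \<subseteq> E" and max: "\<And>F'. F' \<subseteq> E \<Longrightarrow> w F' \<le> w F"
  proof -
    have fi: "finite (w ` Pow E)" using fin by simp
    then have "Max (w ` Pow E) \<in> w ` Pow E" by (intro Max_in) auto
    then obtain F where F: "F \<subseteq> E" "Max (w ` Pow E) = w F" by blast
    show thesis
    proof (rule that[OF F(1)])
      show "w F' \<le> w F" if "F' \<subseteq> E" for F'
        unfolding F(2)[symmetric] using that fi by (intro Max_ge) auto
    qed
  qed
  interpret F: edge_set F using subset[OF F] .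
  \<comment> \<open>An edge at \<open>x\<close> lies in at least \<open>s\<close> triangles, and their third vertices are neighbours of \<open>x\<close>.\<close>
  have deg: "s \<le> real (card (neighbours F x))" if x: "x \<in> \<Union>F" for x
  proof -
    obtain e where e: "e \<in> F" "x \<in> e" using x by blast
    obtain y where exy: "e = {x, y}" using F.two[OF e(1)] e(2) by (auto simp: card_2_iff)
    let ?T = "(\<lambda>z. {x, y, z}) ` neighbours F x"
    have "triangles F \<subseteq> triangles (F - {e}) \<union> ?T"
    proof
      fix T assume T: "T \<in> triangles F"
      show "T \<in> triangles (F - {e}) \<union> ?T"
      proof (cases "e \<subseteq> T")
        case False
        then have "e \<notin> [T]\<^bsup>2\<^esup>" by (simp add: nsets_def)
        then show ?thesis using T by (auto simp: triangles_def)
      next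
        case True
        obtain a b c where T: "T = {a, b, c}" "a \<noteq> b" "b \<noteq> c" "a \<noteq> c"
          and E: "{a, b} \<in> F" "{b, c} \<in> F" "{a, c} \<in> F"
          using T unfolding triangles_iff by blast
        have ne: "x \<noteq> y" using e(1) exy F.loopfree by auto
        have "x \<in> {a, b, c}" "y \<in> {a, b, c}" using True unfolding T exy by auto
        then have "\<exists>z. {x, z} \<in> F \<and> {a, b, c} = {x, y, z}"
          using ne E by (elim insertE) (auto simp: insert_commute)
        then show ?thesis unfolding T by blast
      qed
    qed
    then have "card (triangles F) \<le> card (triangles (F - {e}) \<union> ?T)"
      using edge_set.finite_triangles[OF F.subset[of "F - {e}"]] F.finite_neighbours
      by (intro card_mono) simp_all
    also have "\<dots> \<le> card (triangles (F - {e})) + card ?T" by (rule card_Un_le)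
    also have "card ?T \<le> card (neighbours F x)" by (rule card_image_le[OF F.finite_neighbours])
    finally have "card (triangles F) \<le> card (triangles (F - {e})) + card (neighbours F x)" by simp
    moreover have "w (F - {e}) \<le> w F" using F by (intro max) auto
    moreover have "real (card F) = real (card (F - {e})) + 1"
      using card_Suc_Diff1[OF F.fin e(1)] by linarith
    ultimately show ?thesis by (simp add: w_def algebra_simps)
  qed
  have cF: "real (card F) \<le> real (card E)" using F fin by (simp add: card_mono)
  show thesis
  proof (rule that[OF F])
    have "w E \<le> w F" by (rule max) auto
    moreover have "0 \<le> s * real (card F)" using s by simp
    ultimately show "real (card (triangles E)) \<le> real (card (triangles F)) + s * real (card E)"
      unfolding w_def by linarith
    have "real (card (\<Union>F)) * s = (\<Sum>x\<in>\<Union>F. s)" by simp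
    also have "\<dots> \<le> (\<Sum>x\<in>\<Union>F. real (card (neighbours F x)))" using deg by (rule sum_mono)
    also have "\<dots> = real (card (arcs F))" by (simp add: F.card_arcs)
    also have "\<dots> \<le> 2 * real (card F)" using F.card_arcs_le by linarith
    finally show "real (card (\<Union>F)) * s \<le> 2 * real (card E)" using cF by linarith
  qed
qed

end

section \<open>Breadth-first spanning trees\<close>

text \<open>The parent of a vertex other than the root is one level closer to the root, and \<open>dep_adj\<close> says that
  no edge skips a level. The second property is what controls the triangles that use tree edges.\<close>

locale bfs_tree = edge_set +
  fixes V :: "'a set" and r :: 'a and p :: "'a \<Rightarrow> 'a" and dep :: "'a \<Rightarrow> nat"
  assumes fin_V: "finite V" and EV: "E \<subseteq> [V]\<^bsup>2\<^esup>" and root: "r \<in> V"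
    and parent_edge: "v \<in> V \<Longrightarrow> v \<noteq> r \<Longrightarrow> {v, p v} \<in> E"
    and dep_parent: "v \<in> V \<Longrightarrow> v \<noteq> r \<Longrightarrow> dep v = Suc (dep (p v))"
    and dep_adj: "{u, w} \<in> E \<Longrightarrow> dep w \<le> Suc (dep u)"
begin

definition "tree = (\<lambda>v. {v, p v}) ` (V - {r})"

definition "cotree = E - tree"

lemma tree_subset: "tree \<subseteq> E"
  using parent_edge by (auto simp: tree_def)

sublocale cotree: edge_set cotree
  by (rule subset) (auto simp: cotree_def)

lemma card_cotree: "card E + 1 = card cotree + card V"
proof -
  have "inj_on (\<lambda>v. {v, p v}) (V - {r})"
  proof (rule inj_onI, rule ccontr)
    fix u v assume uv: "u \<in> V - {r}" "v \<in> V - {r}" "{u, p u} = {v, p v}" "u \<noteq> v"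
    then have "u = p v" "v = p u" by (auto simp: doubleton_eq_iff)
    then show False using dep_parent[of u] dep_parent[of v] uv by simp
  qed
  then have "card tree = card V - 1"
    unfolding tree_def using root fin_V by (simp add: card_image)
  moreover have "card V > 0" using root fin_V by (auto simp: card_gt_0_iff)
  moreover have "card E = card cotree + card tree"
    unfolding cotree_def using tree_subset fin
    by (metis card_Diff_subset card_mono finite_subset le_add_diff_inverse2)
  ultimately show ?thesis by simp
qed

text \<open>If \<open>{v, w}\<close> were a tree edge, then \<open>v\<close> would be the parent of \<open>w\<close>, because the parent of \<open>v\<close> is
  not \<open>w\<close>. Then \<open>w\<close> would lie two levels below the parent of \<open>v\<close>, to which it is adjacent.\<close>

lemma cotree_edge:
  assumes v: "v \<in> V" "v \<noteq> r" and w: "{v, w} \<in> E" "{p v, w} \<in> E"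
  shows "{v, w} \<in> cotree"
proof (rule ccontr)
  assume "{v, w} \<notin> cotree"
  then obtain u where u: "u \<in> V" "u \<noteq> r" "{v, w} = {u, p u}"
    using w by (auto simp: cotree_def tree_def)
  have "w \<noteq> p v" using w(2) loopfree by blast
  then have "u = w" "p w = v" using u by (auto simp: doubleton_eq_iff)
  then have "dep w = Suc (Suc (dep (p v)))" using u v dep_parent by metis
  then show False using dep_adj[OF w(2)] by simp
qed

text \<open>A triangle through the tree edge from \<open>v\<close> to its parent is recovered from its cotree edge
  \<open>{v, w}\<close>, traversed from \<open>v\<close> to \<open>w\<close>, by adding the parent of \<open>v\<close>. So there are at most as many such
  triangles as cotree arcs.\<close>

lemma card_triangles_cotree:
  "card (triangles E) \<le> card (triangles cotree) + 2 * card cotree"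
proof -
  let ?g = "\<lambda>a. {fst a, snd a, p (fst a)}"
  have "triangles E \<subseteq> triangles cotree \<union> ?g ` arcs cotree"
  proof
    fix T assume T: "T \<in> triangles E"
    show "T \<in> triangles cotree \<union> ?g ` arcs cotree"
    proof (cases "[T]\<^bsup>2\<^esup> \<inter> tree = {}")
      case True
      then show ?thesis using T by (auto simp: triangles_def cotree_def)
    next
      case False
      then obtain v where v: "v \<in> V" "v \<noteq> r" "{v, p v} \<in> [T]\<^bsup>2\<^esup>"
        unfolding tree_def by blast
      have vT: "{v, p v} \<subseteq> T" "v \<noteq> p v" using v parent_edge loopfree by (auto simp: nsets_def)
      have cT: "card T = 3" "finite T" using T by (auto simp: triangles_def intro: card_ge_0_finite)
      then have "card (T - {v, p v}) = 1" using vT by (simp add: card_Diff_subset)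
      then obtain w where w: "T - {v, p v} = {w}" by (auto simp: card_1_singleton_iff)
      then have Tw: "T = {v, w, p v}" "w \<noteq> v" "w \<noteq> p v" using vT by auto
      then have "{v, w} \<in> [T]\<^bsup>2\<^esup>" "{p v, w} \<in> [T]\<^bsup>2\<^esup>" by (auto simp: nsets_def)
      then have "{v, w} \<in> E" "{p v, w} \<in> E" using T by (auto simp: triangles_def)
      then have "(v, w) \<in> arcs cotree" using cotree_edge v by (simp add: arcs_def)
      then show ?thesis unfolding Tw by force
    qed
  qed
  then have "card (triangles E) \<le> card (triangles cotree \<union> ?g ` arcs cotree)"
    by (intro card_mono) (simp_all add: cotree.finite_triangles cotree.finite_arcs)
  also have "\<dots> \<le> card (triangles cotree) + card (?g ` arcs cotree)" by (rule card_Un_le)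
  also have "card (?g ` arcs cotree) \<le> card (arcs cotree)"
    by (rule card_image_le[OF cotree.finite_arcs])
  finally show ?thesis using cotree.card_arcs_le by linarith
qed

text \<open>The edge from \<open>v\<close> to its parent lies in a triangle, whose other edge at \<open>v\<close> is in the cotree. So
  each vertex except the root is an end of a cotree edge.\<close>

lemma card_verts_cotree:
  assumes "\<And>e. e \<in> E \<Longrightarrow> \<exists>T\<in>triangles E. e \<subseteq> T"
  shows "card V \<le> 2 * card cotree + 1"
proof -
  have "V - {r} \<subseteq> fst ` arcs cotree"
  proof
    fix v assume v: "v \<in> V - {r}"
    obtain T where T: "T \<in> triangles E" "{v, p v} \<subseteq> T" using assms parent_edge v by blast
    have "card T = 3" "finite T" using T by (auto simp: triangles_def intro: card_ge_0_finite)
    moreover have "v \<noteq> p v" using v parent_edge loopfree by auto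
    ultimately have "card (T - {v, p v}) = 1" using T(2) by (simp add: card_Diff_subset)
    then obtain w where w: "T - {v, p v} = {w}" by (auto simp: card_1_singleton_iff)
    then have "{v, w} \<in> [T]\<^bsup>2\<^esup>" "{p v, w} \<in> [T]\<^bsup>2\<^esup>"
      using T(2) by (auto simp: nsets_def card_insert_if)
    then have "{v, w} \<in> E" "{p v, w} \<in> E" using T by (auto simp: triangles_def)
    then have "(v, w) \<in> arcs cotree" using cotree_edge v by (simp add: arcs_def)
    then show "v \<in> fst ` arcs cotree" by force
  qed
  then have "card (V - {r}) \<le> card (fst ` arcs cotree)"
    by (intro card_mono) (simp_all add: cotree.finite_arcs)
  also have "\<dots> \<le> card (arcs cotree)" by (rule card_image_le[OF cotree.finite_arcs])
  also have "\<dots> \<le> 2 * card cotree" by (rule cotree.card_arcs_le)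
  finally show ?thesis using root fin_V by simp
qed

end

lemma connected_imp_bfs_tree:
  assumes fin: "finite V" and EV: "E \<subseteq> [V]\<^bsup>2\<^esup>" and r: "r \<in> V"
    and conn: "\<And>v. v \<in> V \<Longrightarrow> (r, v) \<in> {(x, y). {x, y} \<in> E}\<^sup>*"
  obtains p dep where "bfs_tree E V r p dep"
proof -
  define R where "R = {(x, y). {x, y} \<in> E}"
  define dep where "dep v = (LEAST k. (r, v) \<in> R ^^ k)" for v
  have dep: "(r, v) \<in> R ^^ dep v" if v: "v \<in> V" for v
  proof -
    obtain k where "(r, v) \<in> R ^^ k"
      using conn[OF v] unfolding R_def by (metis rtrancl_imp_relpow)
    then show ?thesis unfolding dep_def by (rule LeastI)
  qed
  have dep_le: "dep v \<le> k" if "(r, v) \<in> R ^^ k" for v k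
    unfolding dep_def using that by (rule Least_le)
  have verts: "u \<in> V" "w \<in> V" if "{u, w} \<in> E" for u w
    using that EV by (auto simp: nsets_def)
  have adj: "dep w \<le> Suc (dep u)" if uw: "{u, w} \<in> E" for u w
  proof (rule dep_le)
    have "(u, w) \<in> R" using uw by (simp add: R_def)
    then show "(r, w) \<in> R ^^ Suc (dep u)" using dep[OF verts(1)[OF uw]] by (rule relpow_Suc_I[rotated])
  qed
  have "\<exists>u. {v, u} \<in> E \<and> dep v = Suc (dep u)" if v: "v \<in> V" "v \<noteq> r" for v
  proof (cases "dep v")
    case 0
    then show ?thesis using dep[OF v(1)] v(2) by simp
  next
    case (Suc k)
    then have "(r, v) \<in> R ^^ Suc k" using dep[OF v(1)] by simp
    then obtain u where u: "(r, u) \<in> R ^^ k" "(u, v) \<in> R" by (rule relpow_Suc_E)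
    have "{u, v} \<in> E" using u(2) by (simp add: R_def)
    then have "dep v \<le> Suc (dep u)" "{v, u} \<in> E" using adj by (auto simp: insert_commute)
    then show ?thesis using dep_le[OF u(1)] Suc by auto
  qed
  then obtain p where p: "\<And>v. v \<in> V \<Longrightarrow> v \<noteq> r \<Longrightarrow> {v, p v} \<in> E \<and> dep v = Suc (dep (p v))"
    by metis
  have "finite E" using EV fin by (simp add: finite_subset finite_imp_finite_nsets)
  then have "bfs_tree E V r p dep"
    using p adj fin r EV by unfold_locales (auto simp: nsets_def)
  then show thesis by (rule that)
qed

section \<open>The excess of a triangle-induced graph\<close>

text \<open>Here \<open>c\<close> is the number of cotree edges of a breadth-first tree.\<close>

lemma
  assumes H: "triangle_induced H" and l: "spanned_by_triangles H l"
  shows spanned_simple: "finite (verts H)" "edges H \<subseteq> [verts H]\<^bsup>2\<^esup>"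
    and spanned_card_verts: "card (verts H) \<le> 3 * l"
    and spanned_le_triangles: "l \<le> card (triangles (edges H))"
    and spanned_excess: "\<exists>c. card (edges H) + 1 = c + card (verts H) \<and> card (verts H) \<le> 2 * c + 1 \<and>
      real l \<le> sqrt 2 / 3 * real c powr (3/2) + 2 * real c"
proof -
  let ?V = "verts H" and ?E = "edges H"
  show fV: "finite ?V" and EE: "?E \<subseteq> [?V]\<^bsup>2\<^esup>"
    using H by (auto simp: triangle_induced_def simple_graph_def)
  obtain \<T> where \<T>: "finite \<T>" "card \<T> = l" "\<And>T. T \<in> \<T> \<Longrightarrow> triangle T" "H = union_graph \<T>"
    using l by (auto simp: spanned_by_triangles_def)
  have Vu: "?V = \<Union> (verts ` \<T>)" and Eu: "?E = \<Union> (edges ` \<T>)"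
    using \<T>(4) by (auto simp: union_graph_def)
  have tri: "verts T \<in> triangles ?E" if T: "T \<in> \<T>" for T
    using \<T>(3)[OF T] T unfolding Eu triangles_def triangle_def by auto
  have "card ?V \<le> (\<Sum>T\<in>\<T>. card (verts T))"
    unfolding Vu by (rule card_UN_le[OF \<T>(1)])
  also have "\<dots> = (\<Sum>T\<in>\<T>. 3)" using \<T>(3) by (intro sum.cong) (auto simp: triangle_def)
  finally show "card ?V \<le> 3 * l" using \<T>(2) by simp
  have finE: "finite ?E" using EE fV by (simp add: finite_subset finite_imp_finite_nsets)
  interpret edge_set ?E using finE EE by unfold_locales (auto simp: nsets_def)
  have "inj_on verts \<T>"
    using \<T>(3) by (intro inj_onI) (auto simp: triangle_def prod_eq_iff)
  then have "l = card (verts ` \<T>)" using \<T>(2) by (simp add: card_image)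
  also have "\<dots> \<le> card (triangles ?E)"
    using tri by (intro card_mono finite_triangles) auto
  finally show lt: "l \<le> card (triangles ?E)" .
  have cov: "\<exists>T\<in>triangles ?E. e \<subseteq> T" if e: "e \<in> ?E" for e
  proof -
    obtain T where T: "T \<in> \<T>" "e \<in> edges T" using e unfolding Eu by blast
    then have "e \<subseteq> verts T" using \<T>(3)[OF T(1)] by (auto simp: triangle_def nsets_def)
    then show ?thesis using tri[OF T(1)] by blast
  qed
  have conn: "connected_graph H" using H by (simp add: triangle_induced_def)
  then obtain r where r: "r \<in> ?V" by (auto simp: connected_graph_def)
  obtain p dep where "bfs_tree ?E ?V r p dep"
    using connected_imp_bfs_tree[OF fV EE r] conn r unfolding connected_graph_def by blast
  then interpret bfs_tree ?E ?V r p dep .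
  let ?c = "card cotree"
  have "real l \<le> real (card (triangles cotree)) + 2 * real ?c"
    using lt card_triangles_cotree by linarith
  then have "real l \<le> sqrt 2 / 3 * real ?c powr (3/2) + 2 * real ?c"
    using cotree.card_triangles_le by linarith
  then show "\<exists>c. card ?E + 1 = c + card ?V \<and> card ?V \<le> 2 * c + 1 \<and>
      real l \<le> sqrt 2 / 3 * real c powr (3/2) + 2 * real c"
    using card_cotree card_verts_cotree[OF cov] by blast
qed

lemma h_exc_props:
  assumes "y > 10"
  shows "h_exc y > 1" "f_exc (h_exc y) = y"
proof -
  obtain x where x: "x \<ge> 0" "f_exc x = y" using f_exc_ex1[OF assms] by blast
  have h: "h_exc y = x" by (rule h_exc_eqI[OF assms x])
  have "f_exc 1 < 10"
  proof -
    have "(2::real) powr (3/2) = 2 * sqrt 2"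
      using powr_add[of "2::real" 1 "1/2"] by (simp add: powr_half_sqrt)
    then show ?thesis by (simp add: f_exc_def)
  qed
  have "x > 1"
  proof (rule ccontr)
    assume "\<not> x > 1"
    then have "f_exc x \<le> f_exc 1"
      using strict_mono_onD[OF f_exc_strict_mono, of x 1] x by (cases "x = 1") auto
    then show False using \<open>f_exc 1 < 10\<close> x assms by simp
  qed
  then show "h_exc y > 1" "f_exc (h_exc y) = y" using h x by auto
qed

lemma h_exc_ge_1: "y \<ge> 2 \<Longrightarrow> h_exc y \<ge> 1"
  using h_exc_props(1)[of y] by (cases "y > 10") (auto simp: h_exc_def)

lemma h_exc_nonneg: "h_exc y \<ge> 0"
  using h_exc_ge_1[of y] by (cases "y \<ge> 2") (auto simp: h_exc_def)

text \<open>For \<open>l > 10\<close> the bound on \<open>l\<close> in \<open>spanned_excess\<close> is at most \<open>f_exc (c - 1)\<close>, and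
  \<open>f_exc\<close> is increasing. For \<open>2 \<le> l \<le> 10\<close> it remains to exclude \<open>c = 1\<close>: such a graph
  has at most three vertices and so at most one triangle.\<close>

lemma h_exc_le_excess:
  assumes H: "triangle_induced H" and sp: "spanned_by_triangles H l" and l: "l \<ge> 2"
  shows "real (card (verts H)) + h_exc (real l) \<le> real (card (edges H))"
proof -
  obtain c where c: "card (edges H) + 1 = c + card (verts H)" "card (verts H) \<le> 2 * c + 1"
      "real l \<le> sqrt 2 / 3 * real c powr (3/2) + 2 * real c"
    using spanned_excess[OF H sp] by blast
  have c0: "c \<noteq> 0" using c(3) l by (intro notI) simp
  show ?thesis
  proof (cases "real l > 10")
    case True
    have "f_exc (h_exc (real l)) \<le> f_exc (real c - 1)"
      using h_exc_props(2)[OF True] c(3) by (simp add: f_exc_def)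
    then have "h_exc (real l) \<le> real c - 1"
      using strict_mono_onD[OF f_exc_strict_mono, of "real c - 1" "h_exc (real l)"]
        h_exc_nonneg[of "real l"] c0 by force
    then show ?thesis using c(1) by linarith
  next
    case False
    have "c \<noteq> 1"
    proof
      assume c1: "c = 1"
      have V3: "card (verts H) \<le> 3" using c(2) c1 by simp
      have "triangles (edges H) \<subseteq> {verts H}"
      proof
        fix T assume T: "T \<in> triangles (edges H)"
        have "T \<subseteq> verts H"
          using T triangles_subset_Pow[of "edges H"] spanned_simple(2)[OF H sp]
          by (auto simp: nsets_def)
        moreover have "card T = 3" using T by (simp add: triangles_def)
        ultimately show "T \<in> {verts H}"
          using card_seteq[OF spanned_simple(1)[OF H sp], of T] V3 by simp
      qed
      then have "card (triangles (edges H)) \<le> 1"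
        using card_mono[of "{verts H}"] by fastforce
      then show False using spanned_le_triangles[OF H sp] l by simp
    qed
    then show ?thesis using c0 c(1) False l by (simp add: h_exc_def)
  qed
qed

section \<open>First moment bounds for the random graph\<close>

lemma sum_Pow_power_card:
  fixes q :: real
  assumes "finite A"
  shows "(\<Sum>X\<in>Pow A. q ^ card X) = (1 + q) ^ card A"
  using prod_add[OF assms, of "\<lambda>_. q" "\<lambda>_. 1"] by (simp add: add.commute)

lemma prob_gnp_contains:
  assumes S: "S \<subseteq> [{0..<n}]\<^bsup>2\<^esup>" and p: "0 \<le> p" "p \<le> 1"
  shows "measure_pmf.prob (gnp n p) {G. S \<subseteq> edges G} = p ^ card S"
proof -
  let ?A = "[{0..<n}]\<^bsup>2\<^esup>"
  let ?B = "\<lambda>e. if e \<in> S then {True} else UNIV"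
  have fin: "finite ?A" by (simp add: finite_imp_finite_nsets)
  have "measure_pmf.prob (gnp n p) {G. S \<subseteq> edges G} =
    measure_pmf.prob (Pi_pmf ?A False (\<lambda>_. bernoulli_pmf p)) (Pi ?A ?B)"
    unfolding gnp_def measure_map_pmf using S
    by (intro arg_cong2[of _ _ _ _ measure] refl) (auto simp: Pi_def)
  also have "\<dots> = (\<Prod>e\<in>?A. measure_pmf.prob (bernoulli_pmf p) (?B e))"
    by (rule measure_Pi_pmf_Pi[OF fin])
  also have "\<dots> = (\<Prod>e\<in>?A. if e \<in> S then p else 1)"
    using p by (intro prod.cong) (auto simp: measure_pmf_single)
  also have "\<dots> = p ^ card S"
    using S fin by (simp add: prod.If_cases Int_absorb1)
  finally show ?thesis .
qed

text \<open>A first moment bound. The vertex sets contribute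
  \<open>\<Sum> (1/n) ^ card V = (1 + 1/n) ^ n\<close>, which is at most 3, and on each of them the edge sets contribute
  \<open>\<Sum> q ^ card E\<close>, which is \<open>1 + q\<close> to the power of the number of pairs of vertices. The parameter \<open>q\<close>
  is a price per edge; how small it can be made depends on how much of the factor \<open>(1/n) ^ card E\<close>
  may be spent on the union over the edge sets.\<close>

lemma prob_gnp_contains_some_le:
  fixes d q Y M :: real
  assumes n: "n > 0" and d: "0 \<le> d" "d \<le> real n" and q: "0 \<le> q" and Y: "0 \<le> Y"
    and \<S>: "\<And>V E. (V, E) \<in> \<S> \<Longrightarrow> V \<subseteq> {0..<n} \<and> E \<subseteq> [V]\<^bsup>2\<^esup> \<and> (real (card V))\<^sup>2 \<le> M \<and>
      (d / real n) ^ card E \<le> Y * (1 / real n) ^ card V * q ^ card E"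
  shows "measure_pmf.prob (gnp n (d / real n)) {G. \<exists>S\<in>\<S>. edges S \<subseteq> edges G}
    \<le> 3 * (1 + q) powr M * Y"
proof -
  let ?P = "measure_pmf.prob (gnp n (d / real n))"
  let ?w = "\<lambda>V E. Y * (1 / real n) ^ card V * q ^ card E"
  define \<V> where "\<V> = {V \<in> Pow {0..<n}. (real (card V))\<^sup>2 \<le> M}"
  have fV: "finite \<V>" "\<And>V. V \<in> \<V> \<Longrightarrow> finite V"
    by (auto simp: \<V>_def intro: finite_subset)
  have fE: "finite ([V]\<^bsup>2\<^esup>)" if "V \<in> \<V>" for V
    using fV(2)[OF that] by (simp add: finite_imp_finite_nsets)
  have sub: "\<S> \<subseteq> Sigma \<V> (\<lambda>V. Pow ([V]\<^bsup>2\<^esup>))"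
    using \<S> by (auto simp: \<V>_def)
  have fS: "finite (Sigma \<V> (\<lambda>V. Pow ([V]\<^bsup>2\<^esup>)))"
    using fV fE by (intro finite_SigmaI) auto
  have "?P {G. \<exists>S\<in>\<S>. edges S \<subseteq> edges G} = ?P (\<Union>S\<in>\<S>. {G. snd S \<subseteq> edges G})"
    by (intro arg_cong[of _ _ ?P]) auto
  also have "\<dots> \<le> (\<Sum>S\<in>\<S>. ?P {G. snd S \<subseteq> edges G})"
    using finite_subset[OF sub fS] by (rule measure_UNION_le) simp
  also have "\<dots> \<le> (\<Sum>(V, E)\<in>\<S>. ?w V E)"
  proof (rule sum_mono, clarify)
    fix V E assume VE: "(V, E) \<in> \<S>"
    have "E \<subseteq> [{0..<n}]\<^bsup>2\<^esup>" using \<S>[OF VE] by (meson nsets_mono order_trans)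
    then have "?P {G. E \<subseteq> edges G} = (d / real n) ^ card E"
      using d n by (intro prob_gnp_contains) auto
    then show "?P {G. snd (V, E) \<subseteq> edges G} \<le> ?w V E" using \<S>[OF VE] by simp
  qed
  also have "\<dots> \<le> (\<Sum>(V, E)\<in>Sigma \<V> (\<lambda>V. Pow ([V]\<^bsup>2\<^esup>)). ?w V E)"
    using sub fS q Y by (intro sum_mono2) auto
  also have "\<dots> = (\<Sum>V\<in>\<V>. \<Sum>E\<in>Pow ([V]\<^bsup>2\<^esup>). ?w V E)"
    using fV fE by (intro sum.Sigma[symmetric]) auto
  also have "\<dots> = (\<Sum>V\<in>\<V>. Y * (1 / real n) ^ card V * (1 + q) ^ (card V choose 2))"
    using fE by (intro sum.cong) (simp_all add: sum_Pow_power_card flip: sum_distrib_left)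
  also have "\<dots> \<le> (\<Sum>V\<in>\<V>. Y * (1 / real n) ^ card V * (1 + q) powr M)"
  proof (intro sum_mono mult_left_mono)
    fix V assume V: "V \<in> \<V>"
    have "card V choose 2 \<le> (card V)\<^sup>2"
      by (simp add: choose_two power2_eq_square) (meson diff_le_self div_le_dividend le_trans mult_le_mono2)
    then have "real (card V choose 2) \<le> (real (card V))\<^sup>2" by (metis of_nat_le_iff of_nat_power)
    also have "\<dots> \<le> M" using V by (simp add: \<V>_def)
    finally have "(1 + q) powr real (card V choose 2) \<le> (1 + q) powr M"
      using q by (intro powr_mono) auto
    then show "(1 + q) ^ (card V choose 2) \<le> (1 + q) powr M"
      using q by (simp add: powr_realpow)
  qed (use Y in auto)
  also have "\<dots> = Y * (1 + q) powr M * (\<Sum>V\<in>\<V>. (1 / real n) ^ card V)"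
    by (simp add: sum_distrib_left mult_ac)
  also have "\<dots> \<le> Y * (1 + q) powr M * 3"
  proof (intro mult_left_mono)
    have "(\<Sum>V\<in>\<V>. (1 / real n) ^ card V) \<le> (\<Sum>V\<in>Pow {0..<n}. (1 / real n) ^ card V)"
      by (intro sum_mono2) (auto simp: \<V>_def)
    also have "\<dots> = (1 + 1 / real n) ^ n" by (simp add: sum_Pow_power_card)
    also have "\<dots> \<le> exp 1" using n by (intro exp_ge_one_plus_x_over_n_power_n) auto
    also have "\<dots> \<le> 3" by (rule exp_le)
    finally show "(\<Sum>V\<in>\<V>. (1 / real n) ^ card V) \<le> 3" .
  qed (use Y in auto)
  finally show ?thesis by (simp add: mult_ac)
qed

definition copies_of_excess :: "nat \<Rightarrow> real \<Rightarrow> real \<Rightarrow> nat graph set" where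
  "copies_of_excess n M \<kappa> = {(V, E). V \<subseteq> {0..<n} \<and> E \<subseteq> [V]\<^bsup>2\<^esup> \<and>
     (real (card V))\<^sup>2 \<le> M \<and> real (card V) + \<kappa> \<le> real (card E)}"

abbreviation contains_some :: "'a graph set \<Rightarrow> 'a graph set" where
  "contains_some \<S> \<equiv> {G. \<exists>S\<in>\<S>. edges S \<subseteq> edges G}"

lemma powr_inverse_nat: "n > 0 \<Longrightarrow> (1 / real n) powr x = real n powr (- x)"
  by (simp add: powr_minus powr_divide inverse_eq_divide)

text \<open>With price \<open>d\<close> per edge the whole excess is kept. This is efficient when \<open>M\<close>, the bound on the
  square of the number of vertices, is at most of the order of \<open>\<kappa>\<close> or bounded.\<close>

lemma prob_dense_le:
  assumes n: "n > 0" and d: "0 \<le> d" "d \<le> real n"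
  shows "measure_pmf.prob (gnp n (d / real n)) (contains_some (copies_of_excess n M \<kappa>))
    \<le> 3 * (1 + d) powr M * real n powr (- \<kappa>)"
proof (rule prob_gnp_contains_some_le[OF n d d(1)])
  fix V E assume VE: "(V, E) \<in> copies_of_excess n M \<kappa>"
  let ?v = "card V" and ?e = "card E"
  have "(1 / real n) ^ ?e = real n powr (- real ?e)"
    using n by (simp add: powr_inverse_nat flip: powr_realpow)
  also have "\<dots> \<le> real n powr (- \<kappa> - real ?v)"
    using n VE by (intro powr_mono) (auto simp: copies_of_excess_def)
  also have "\<dots> = real n powr (- \<kappa>) * (1 / real n) ^ ?v"
    using n by (simp add: powr_diff powr_realpow power_one_over)
  finally have "d ^ ?e * (1 / real n) ^ ?e \<le> d ^ ?e * (real n powr (- \<kappa>) * (1 / real n) ^ ?v)"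
    using d by (intro mult_left_mono) auto
  then have "(d / real n) ^ ?e \<le> real n powr (- \<kappa>) * (1 / real n) ^ ?v * d ^ ?e"
    by (simp add: power_divide mult_ac)
  then show "V \<subseteq> {0..<n} \<and> E \<subseteq> [V]\<^bsup>2\<^esup> \<and> (real ?v)\<^sup>2 \<le> M \<and>
      (d / real n) ^ ?e \<le> real n powr (- \<kappa>) * (1 / real n) ^ ?v * d ^ ?e"
    using VE by (simp add: copies_of_excess_def)
qed simp

text \<open>Here a factor \<open>n powr (- 1/5)\<close> per edge is spent on the union over the edge sets. By the bound on
  the number of vertices this leaves two fifths of the excess, up to a constant: the sum of 2/5 of
  \<open>v + \<kappa> \<le> e\<close> and 1/5 of \<open>3 v \<le> 2 e + 3\<close> is \<open>v + 2/5 \<kappa> - 3/5 \<le> 4/5 e\<close>.\<close>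

lemma prob_sparse_le:
  assumes n: "n > 0" and d: "0 \<le> d" "d \<le> real n"
  shows "measure_pmf.prob (gnp n (d / real n)) (contains_some
      (copies_of_excess n M \<kappa> \<inter> {(V, E). 3 * card V \<le> 2 * card E + 3}))
    \<le> 3 * (1 + d * real n powr (- 1 / 5)) powr M * real n powr (3 / 5 - 2 / 5 * \<kappa>)"
proof (rule prob_gnp_contains_some_le[OF n d])
  let ?q = "d * real n powr (- 1 / 5)" and ?Y = "real n powr (3 / 5 - 2 / 5 * \<kappa>)"
  fix V E assume VE: "(V, E) \<in> copies_of_excess n M \<kappa> \<inter> {(V, E). 3 * card V \<le> 2 * card E + 3}"
  let ?v = "card V" and ?e = "card E"
  have ex: "real ?v + \<kappa> \<le> real ?e" "3 * real ?v \<le> 2 * real ?e + 3"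
    using VE by (auto simp: copies_of_excess_def)
  have "(1 / real n) ^ ?e = real n powr (- real ?e)"
    using n by (simp add: powr_inverse_nat flip: powr_realpow)
  also have "\<dots> \<le> real n powr ((3 / 5 - 2 / 5 * \<kappa>) + (- real ?v) + (- 1 / 5) * real ?e)"
    using n ex by (intro powr_mono) auto
  also have "\<dots> = ?Y * (1 / real n) ^ ?v * (real n powr (- 1 / 5)) powr real ?e"
    using n by (simp only: powr_add powr_powr) (simp add: powr_minus powr_realpow power_one_over inverse_eq_divide)
  also have "(real n powr (- 1 / 5)) powr real ?e = (real n powr (- 1 / 5)) ^ ?e"
    using n by (simp add: powr_realpow)
  finally have "d ^ ?e * (1 / real n) ^ ?e \<le> d ^ ?e * (?Y * (1 / real n) ^ ?v * (real n powr (- 1 / 5)) ^ ?e)"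
    using d by (intro mult_left_mono) auto
  then have "(d / real n) ^ ?e \<le> ?Y * (1 / real n) ^ ?v * ?q ^ ?e"
    by (simp add: power_divide power_mult_distrib mult_ac)
  then show "V \<subseteq> {0..<n} \<and> E \<subseteq> [V]\<^bsup>2\<^esup> \<and> (real ?v)\<^sup>2 \<le> M \<and>
      (d / real n) ^ ?e \<le> ?Y * (1 / real n) ^ ?v * ?q ^ ?e"
    using VE by (simp add: copies_of_excess_def)
qed (use d in simp_all)

section \<open>Dense cores of spanned graphs\<close>

lemma powr_three_halves: "x \<ge> 0 \<Longrightarrow> x powr (3/2) = x * sqrt x" for x :: real
  using powr_add[of x 1 "1/2"] by (simp add: powr_half_sqrt)

lemma powr_three_halves_le_imp_le:
  assumes x: "0 \<le> x" and y: "0 \<le> y" and \<delta>: "0 \<le> \<delta>" "\<delta> \<le> 1"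
    and le: "(1 - \<delta>) * y powr (3/2) \<le> x powr (3/2)"
  shows "(1 - \<delta>) * y \<le> (x::real)"
proof (rule ccontr)
  assume "\<not> (1 - \<delta>) * y \<le> x"
  then have "x powr (3/2) < ((1 - \<delta>) * y) powr (3/2)"
    using x by (intro powr_less_mono2) auto
  also have "\<dots> = (1 - \<delta>) powr (3/2) * y powr (3/2)"
    using y \<delta> by (simp add: powr_mult)
  also have "\<dots> \<le> (1 - \<delta>) * y powr (3/2)"
    using \<delta> by (intro mult_right_mono) (auto simp: powr_three_halves mult_left_le)
  finally show False using le by simp
qed

text \<open>Apply \<open>dense_core\<close> with threshold \<open>\<theta> * sqrt h\<close>. There are at most \<open>18 h\<close> edges, so at most
  \<open>36 / \<theta> * sqrt h\<close> vertices survive and at most \<open>18 \<theta> * h powr (3/2)\<close> triangles are lost. This is at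
  most a fraction \<open>54 \<theta> = \<eta> / 4\<close> of the main term \<open>sqrt 2 / 3 * h powr (3/2)\<close> of \<open>f_exc h = l\<close>, so
  by \<open>card_triangles_le\<close> at least \<open>(1 - \<eta>/4) h\<close> edges survive. The lower bound on \<open>h\<close> makes the number
  of surviving vertices at most \<open>\<eta>/4 * h\<close>.\<close>

lemma dense_subgraph_of_spanned:
  fixes \<eta> :: real
  defines "\<theta> \<equiv> \<eta> / 216"
  assumes H: "triangle_induced H" and sp: "spanned_by_triangles H l"
    and \<eta>: "0 < \<eta>" "\<eta> < 1" and large: "(144 / (\<theta> * \<eta>))\<^sup>2 \<le> h_exc (real l)" and l10: "real l > 10"
    and few: "real (card (edges H)) \<le> real (card (verts H)) + 5 * h_exc (real l)"
  obtains F where "F \<subseteq> edges H" "F \<subseteq> [\<Union>F]\<^bsup>2\<^esup>"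
    "(real (card (\<Union>F)))\<^sup>2 \<le> (36 / \<theta>)\<^sup>2 * h_exc (real l)"
    "real (card (\<Union>F)) + (1 - \<eta> / 2) * h_exc (real l) \<le> real (card F)"
proof -
  define h where "h = h_exc (real l)"
  let ?E = "edges H"
  have h: "h > 1" "f_exc h = real l" using h_exc_props[OF l10] by (auto simp: h_def)
  have \<theta>: "\<theta> > 0" using \<eta> by (simp add: \<theta>_def)
  have "finite ?E" using spanned_simple[OF H sp] by (simp add: finite_subset finite_imp_finite_nsets)
  then interpret edge_set ?E
    using spanned_simple(2)[OF H sp] by unfold_locales (auto simp: nsets_def)
  obtain c where c: "card ?E + 1 = c + card (verts H)" "card (verts H) \<le> 2 * c + 1"
    using spanned_excess[OF H sp] by blast
  have e18: "real (card ?E) \<le> 18 * h" using c few h(1) unfolding h_def[symmetric] by linarith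
  define s where "s = \<theta> * sqrt h"
  have s: "s > 0" using \<theta> h by (simp add: s_def)
  obtain F where F: "F \<subseteq> ?E"
      "real (card (triangles ?E)) \<le> real (card (triangles F)) + s * real (card ?E)"
      "real (card (\<Union>F)) * s \<le> 2 * real (card ?E)"
    using dense_core[of s] s by auto
  interpret F: edge_set F using subset[OF F(1)] .
  have "real (card (\<Union>F)) * s \<le> 36 * h" using F(3) e18 by linarith
  also have "\<dots> = 36 * sqrt h * sqrt h" using h by simp
  finally have "(real (card (\<Union>F)) * \<theta>) * sqrt h \<le> (36 * sqrt h) * sqrt h"
    by (simp add: s_def mult_ac)
  then have "real (card (\<Union>F)) * \<theta> \<le> 36 * sqrt h" using h by simp
  then have v: "real (card (\<Union>F)) \<le> 36 / \<theta> * sqrt h" using \<theta> by (simp add: field_simps)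
  have v2: "(real (card (\<Union>F)))\<^sup>2 \<le> (36 / \<theta>)\<^sup>2 * h"
    using power_mono[OF v, of 2] h by (simp add: power_mult_distrib power_divide)
  have "144 / (\<theta> * \<eta>) \<le> sqrt h" using large unfolding h_def[symmetric] by (rule real_le_rsqrt)
  then have "36 / \<theta> \<le> \<eta> / 4 * sqrt h" using \<theta> \<eta> by (simp add: field_simps)
  then have "36 / \<theta> * sqrt h \<le> \<eta> / 4 * sqrt h * sqrt h" using h by (intro mult_right_mono) auto
  also have "\<dots> = \<eta> / 4 * h" using h by simp
  finally have v3: "real (card (\<Union>F)) \<le> \<eta> / 4 * h" using v by linarith
  have "sqrt 2 / 3 * h powr (3/2) \<le> f_exc h"
  proof -
    have "sqrt 2 / 3 * h powr (3/2) \<le> sqrt 2 / 3 * (h + 1) powr (3/2)"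
      using h by (intro mult_left_mono powr_mono2) auto
    then show ?thesis unfolding f_exc_def by (rule add_increasing2[rotated]) (use h in simp)
  qed
  also have "\<dots> \<le> real (card (triangles ?E))"
    using spanned_le_triangles[OF H sp] h by simp
  also have "\<dots> \<le> sqrt 2 / 3 * real (card F) powr (3/2) + s * (18 * h)"
    using F(2) F.card_triangles_le mult_left_mono[OF e18, of s] s by linarith
  also have "s * (18 * h) = 18 * \<theta> * h powr (3/2)"
    using h by (simp add: s_def powr_three_halves mult_ac)
  also have "\<dots> \<le> sqrt 2 / 3 * (54 * \<theta> * h powr (3/2))"
    using mult_right_mono[of 1 "sqrt 2" "18 * (\<theta> * h powr (3/2))"] \<theta> by (simp add: mult_ac)
  finally have "sqrt 2 / 3 * ((1 - 54 * \<theta>) * h powr (3/2)) \<le> sqrt 2 / 3 * real (card F) powr (3/2)"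
    by (simp add: algebra_simps)
  then have "(1 - \<eta> / 4) * h powr (3/2) \<le> real (card F) powr (3/2)"
    by (simp add: \<theta>_def)
  then have "(1 - \<eta> / 4) * h \<le> real (card F)"
    by (rule powr_three_halves_le_imp_le[rotated -1]) (use \<eta> h in simp_all)
  then have ex: "real (card (\<Union>F)) + (1 - \<eta> / 2) * h \<le> real (card F)"
    using v3 by (simp add: algebra_simps)
  have "F \<subseteq> [\<Union>F]\<^bsup>2\<^esup>"
    using F.two by (auto simp: nsets_def intro: card_ge_0_finite)
  then show thesis using that[OF F(1)] v2 ex unfolding h_def by blast
qed

section \<open>The probability bound\<close>

lemma prob_F_event_le:
  assumes "\<And>G H. \<lbrakk>verts G = {0..<n}; subgraph H G; triangle_induced H; spanned_by_triangles H l\<rbrakk> \<Longrightarrow> G \<in> A"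
  shows "measure_pmf.prob (gnp n p) (F_event l) \<le> measure_pmf.prob (gnp n p) A"
proof -
  have "measure_pmf.prob (gnp n p) (F_event l) =
      measure_pmf.prob (gnp n p) (F_event l \<inter> set_pmf (gnp n p))"
    by (simp add: measure_Int_set_pmf)
  also have "\<dots> \<le> measure_pmf.prob (gnp n p) A"
  proof (rule measure_pmf.finite_measure_mono)
    show "F_event l \<inter> set_pmf (gnp n p) \<subseteq> A"
    proof
      fix G assume G: "G \<in> F_event l \<inter> set_pmf (gnp n p)"
      then have "verts G = {0..<n}" by (auto simp: gnp_def)
      moreover obtain H where "subgraph H G" "triangle_induced H" "spanned_by_triangles H l"
        using G unfolding F_event_def by blast
      ultimately show "G \<in> A" by (rule assms)
    qed
  qed simp
  finally show ?thesis .
qed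

lemma eventually_powr_ge:
  assumes "a > 0"
  shows "\<forall>\<^sub>F n in sequentially. C \<le> real n powr a"
proof -
  have "\<forall>\<^sub>F n in sequentially. max 0 C powr (1 / a) \<le> real n"
    using filterlim_real_sequentially by (auto simp: filterlim_at_top)
  then show ?thesis
  proof eventually_elim
    case (elim n)
    have "C \<le> max 0 C" by simp
    also have "\<dots> = (max 0 C powr (1 / a)) powr a" using assms by (simp add: powr_powr)
    also have "\<dots> \<le> real n powr a" using elim assms by (intro powr_mono2) auto
    finally show ?case .
  qed
qed

theorem lemma4p4:
  fixes d \<mu> \<eta> :: real
  assumes "d > 0" and "\<mu> > 0" and "\<eta> > 0"
  shows "\<forall>\<^sub>F n in sequentially. \<forall>l::nat. 1 \<le> l \<and> real l \<le> real n powr (1 / 10 - \<mu>) \<longrightarrow>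
    measure_pmf.prob (gnp n (d / real n)) (F_event l)
      \<le> (1 / real n) powr ((1 - \<eta>) * h_exc (real l))"
proof -
  note d = \<open>d > 0\<close>
  \<comment> \<open>Below \<open>h0\<close> the vertex number is bounded by \<open>3 L\<close>; from \<open>h0\<close> on \<open>dense_subgraph_of_spanned\<close> applies.\<close>
  define \<theta> where "\<theta> = \<eta> / 216"
  define h0 where "h0 = (144 / (\<theta> * \<eta>))\<^sup>2"
  define L where "L = max 10 (f_exc h0)"
  define C where "C = 3 * (1 + d) powr (9 * L\<^sup>2)"
  define B where "B = (36 / \<theta>)\<^sup>2"
  have "\<forall>\<^sub>F n in sequentially. d \<le> real n"
    using filterlim_real_sequentially by (auto simp: filterlim_at_top)
  moreover have "\<forall>\<^sub>F n in sequentially. C \<le> real n powr \<eta>"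
    and "\<forall>\<^sub>F n in sequentially. (1 + d) powr B \<le> real n powr (\<eta> / 4)"
    and "\<forall>\<^sub>F n in sequentially. 3 + 3 * exp (9 * d) \<le> real n powr (\<eta> / 4)"
    using \<open>\<eta> > 0\<close> by (simp_all add: eventually_powr_ge)
  moreover have "\<forall>\<^sub>F n in sequentially. n > (0::nat)" by (rule eventually_gt_at_top)
  ultimately show ?thesis
  proof (eventually_elim, intro allI impI, elim conjE)
    fix n l :: nat
    assume dn: "d \<le> real n" and C: "C \<le> real n powr \<eta>"
      and B: "(1 + d) powr B \<le> real n powr (\<eta> / 4)"
      and D: "3 + 3 * exp (9 * d) \<le> real n powr (\<eta> / 4)" and n: "n > 0"
      and l: "1 \<le> l" "real l \<le> real n powr (1 / 10 - \<mu>)"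
    let ?P = "measure_pmf.prob (gnp n (d / real n))"
    define h where "h = h_exc (real l)"
    have n1: "real n \<ge> 1" using n by simp
    have "h \<ge> 0" using h_exc_nonneg by (simp add: h_def)
    then consider "(1 - \<eta>) * h \<le> 0" | "\<eta> < 1" "h > 0"
      by (cases "\<eta> < 1"; cases "h > 0") (auto simp: mult_nonpos_nonneg)
    then have "?P (F_event l) \<le> real n powr (- ((1 - \<eta>) * h))"
    proof cases
      case 1
      have "?P (F_event l) \<le> 1" by simp
      also have "\<dots> \<le> real n powr (- ((1 - \<eta>) * h))" using 1 n1 by (intro ge_one_powr_ge_zero) auto
      finally show ?thesis .
    next
      case 2
      have l2: "l \<ge> 2" using 2(2) by (auto simp: h_def h_exc_def split: if_splits)
      have h1: "h \<ge> 1" unfolding h_def using l2 by (intro h_exc_ge_1) simp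
      have excess: "real (card (verts H)) + h \<le> real (card (edges H))"
        if "triangle_induced H" "spanned_by_triangles H l" for H :: "nat graph"
        unfolding h_def using h_exc_le_excess[OF that l2] .
      have card_verts: "(real (card (verts H)))\<^sup>2 \<le> 9 * (real l)\<^sup>2"
        if "triangle_induced H" "spanned_by_triangles H l" for H :: "nat graph"
      proof -
        have "real (card (verts H)) \<le> 3 * real l" using spanned_card_verts[OF that] by linarith
        from power_mono[OF this, of 2] show ?thesis by (simp add: power_mult_distrib)
      qed
      show ?thesis
      proof (cases "h < h0")
        case True
        have lL: "real l \<le> L"
        proof (cases "real l > 10")
          case l10: True
          have "f_exc h < f_exc h0"
            using h1 True by (intro strict_mono_onD[OF f_exc_strict_mono]) auto
          then show ?thesis using h_exc_props(2)[OF l10] by (simp add: h_def L_def)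
        qed (simp add: L_def)
        then have "9 * (real l)\<^sup>2 \<le> 9 * L\<^sup>2" by (intro mult_left_mono power_mono) auto
        note M = order_trans[OF card_verts this]
        have "?P (F_event l) \<le> ?P (contains_some (copies_of_excess n (9 * L\<^sup>2) h))"
        proof (rule prob_F_event_le)
          fix G H :: "nat graph"
          assume G: "verts G = {0..<n}" and H: "subgraph H G" "triangle_induced H" "spanned_by_triangles H l"
          then have "H \<in> copies_of_excess n (9 * L\<^sup>2) h"
            using excess[OF H(2,3)] M[OF H(2,3)]
            by (simp add: copies_of_excess_def subgraph_def simple_graph_def case_prod_unfold)
          then show "G \<in> contains_some (copies_of_excess n (9 * L\<^sup>2) h)"
            using H(1) unfolding subgraph_def by blast
        qed
        also have "\<dots> \<le> C * real n powr (- h)"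
          unfolding C_def using d by (intro prob_dense_le[OF n _ dn]) simp
        also have "C \<le> real n powr (\<eta> * h)"
        proof -
          have "\<eta> * 1 \<le> \<eta> * h" using h1 \<open>\<eta> > 0\<close> by (intro mult_left_mono) auto
          then have "real n powr \<eta> \<le> real n powr (\<eta> * h)" using n1 by (intro powr_mono) auto
          then show ?thesis using C by simp
        qed
        then have "C * real n powr (- h) \<le> real n powr (\<eta> * h) * real n powr (- h)"
          by (intro mult_right_mono) auto
        also have "\<dots> = real n powr (- ((1 - \<eta>) * h))" by (simp add: algebra_simps flip: powr_add)
        finally show ?thesis .
      next
        case False
        have l10: "real l > 10"
        proof (rule ccontr)
          assume "\<not> real l > 10"
          then have "h \<le> 1" by (simp add: h_def h_exc_def)
          moreover have "\<theta> * \<eta> \<le> 1 / 216"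
            using \<open>\<eta> > 0\<close> 2 mult_le_one[of \<eta> \<eta>] by (simp add: \<theta>_def)
          then have "144 < 144 / (\<theta> * \<eta>)" using \<open>\<eta> > 0\<close> by (simp add: field_simps \<theta>_def)
          then have "144\<^sup>2 < h0" unfolding h0_def by (intro power_strict_mono) auto
          ultimately show False using False by simp
        qed
        \<comment> \<open>\<open>?A\<close> collects the dense cores, \<open>?S\<close> the graphs whose excess is at least \<open>5 h\<close>.\<close>
        let ?A = "copies_of_excess n (B * h) ((1 - \<eta> / 2) * h)"
        let ?S = "copies_of_excess n (9 * (real l)\<^sup>2) (5 * h) \<inter> {(V, E). 3 * card V \<le> 2 * card E + 3}"
        have "?P (F_event l) \<le> ?P (contains_some ?A \<union> contains_some ?S)"
        proof (rule prob_F_event_le)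
          fix G H :: "nat graph"
          assume G: "verts G = {0..<n}" and H: "subgraph H G" "triangle_induced H" "spanned_by_triangles H l"
          have sub: "verts H \<subseteq> {0..<n}" "edges H \<subseteq> [verts H]\<^bsup>2\<^esup>" "edges H \<subseteq> edges G"
            using G H(1) by (auto simp: subgraph_def simple_graph_def)
          show "G \<in> contains_some ?A \<union> contains_some ?S"
          proof (cases "real (card (verts H)) + 5 * h \<le> real (card (edges H))")
            case True
            obtain c where "card (edges H) + 1 = c + card (verts H)" "card (verts H) \<le> 2 * c + 1"
              using spanned_excess[OF H(2,3)] by blast
            then have "3 * card (verts H) \<le> 2 * card (edges H) + 3" by linarith
            then have "H \<in> ?S"
              using True sub card_verts[OF H(2,3)] by (simp add: copies_of_excess_def case_prod_unfold)
            then show ?thesis using sub(3) by blast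
          next
            case few: False
            have large: "(144 / (\<eta> / 216 * \<eta>))\<^sup>2 \<le> h_exc (real l)"
              using False unfolding h_def h0_def \<theta>_def by linarith
            have few': "real (card (edges H)) \<le> real (card (verts H)) + 5 * h_exc (real l)"
              using few unfolding h_def by linarith
            obtain F where F: "F \<subseteq> edges H" "F \<subseteq> [\<Union>F]\<^bsup>2\<^esup>"
                "(real (card (\<Union>F)))\<^sup>2 \<le> B * h"
                "real (card (\<Union>F)) + (1 - \<eta> / 2) * h \<le> real (card F)"
              using dense_subgraph_of_spanned[OF H(2,3) \<open>\<eta> > 0\<close> 2(1) large l10 few']
              unfolding h_def \<theta>_def B_def by blast
            have "\<Union>F \<subseteq> {0..<n}" using F(1) sub by (fastforce simp: nsets_def)
            then have "(\<Union>F, F) \<in> ?A" using F by (simp add: copies_of_excess_def)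
            then have "G \<in> contains_some ?A"
              using F(1) sub(3) by (auto intro!: bexI[of _ "(\<Union>F, F)"])
            then show ?thesis ..
          qed
        qed
        also have "\<dots> \<le> ?P (contains_some ?A) + ?P (contains_some ?S)"
          by (rule measure_Un_le) simp_all
        also have "?P (contains_some ?A) \<le> 3 * real n powr (- ((1 - 3 / 4 * \<eta>) * h))"
        proof -
          have "?P (contains_some ?A) \<le> 3 * (1 + d) powr (B * h) * real n powr (- ((1 - \<eta> / 2) * h))"
            using d by (intro prob_dense_le[OF n _ dn]) simp
          also have "(1 + d) powr (B * h) \<le> (real n powr (\<eta> / 4)) powr h"
            using B h1 unfolding powr_powr[symmetric] by (intro powr_mono2) auto
          then have "3 * (1 + d) powr (B * h) * real n powr (- ((1 - \<eta> / 2) * h))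
            \<le> 3 * (real n powr (\<eta> / 4)) powr h * real n powr (- ((1 - \<eta> / 2) * h))"
            by (intro mult_right_mono mult_left_mono) auto
          also have "\<dots> = 3 * real n powr (- ((1 - 3 / 4 * \<eta>) * h))"
            by (simp add: powr_powr algebra_simps flip: powr_add)
          finally show ?thesis .
        qed
        also have "?P (contains_some ?S) \<le> 3 * exp (9 * d) * real n powr (- ((1 - 3 / 4 * \<eta>) * h))"
        proof -
          let ?q = "d * real n powr (- 1 / 5)"
          have "?P (contains_some ?S)
              \<le> 3 * (1 + ?q) powr (9 * (real l)\<^sup>2) * real n powr (3 / 5 - 2 / 5 * (5 * h))"
            using d by (intro prob_sparse_le[OF n _ dn]) simp
          also have "\<dots> \<le> 3 * exp (9 * d) * real n powr (- ((1 - 3 / 4 * \<eta>) * h))"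
          proof (intro mult_mono mult_left_mono)
            have q: "?q \<ge> 0" using d by simp
            \<comment> \<open>The union over edge sets costs only a constant since \<open>l\<^sup>2\<close> is at most \<open>n powr (1/5)\<close>.\<close>
            have "(real l)\<^sup>2 \<le> (real n powr (1 / 10 - \<mu>))\<^sup>2" using l by (intro power_mono) auto
            also have "\<dots> = real n powr (1 / 5 - 2 * \<mu>)"
              by (simp add: power2_eq_square flip: powr_add)
            also have "\<dots> \<le> real n powr (1 / 5)" using n1 \<open>\<mu> > 0\<close> by (intro powr_mono) auto
            finally have "?q * (9 * (real l)\<^sup>2) \<le> ?q * (9 * real n powr (1 / 5))"
              using q by (intro mult_left_mono) auto
            also have "\<dots> = 9 * d * (real n powr (- 1 / 5) * real n powr (1 / 5))" by simp
            also have "\<dots> = 9 * d" using n by (simp flip: powr_add)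
            finally have qM: "?q * (9 * (real l)\<^sup>2) \<le> 9 * d" .
            have "(1 + ?q) powr (9 * (real l)\<^sup>2) = exp (9 * (real l)\<^sup>2 * ln (1 + ?q))"
              using q by (simp add: powr_def)
            also have "9 * (real l)\<^sup>2 * ln (1 + ?q) \<le> 9 * (real l)\<^sup>2 * ?q"
              using q by (intro mult_left_mono ln_add_one_self_le_self) auto
            also have "\<dots> = ?q * (9 * (real l)\<^sup>2)" by (rule mult.commute)
            also note qM
            finally show "(1 + ?q) powr (9 * (real l)\<^sup>2) \<le> exp (9 * d)" by simp
            have "0 \<le> 3 / 4 * \<eta> * h" using \<open>\<eta> > 0\<close> h1 by simp
            then show "real n powr (3 / 5 - 2 / 5 * (5 * h)) \<le> real n powr (- ((1 - 3 / 4 * \<eta>) * h))"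
              using n1 h1 by (intro powr_mono) (simp_all add: algebra_simps)
          qed auto
          finally show ?thesis .
        qed
        finally have "?P (F_event l) \<le> (3 + 3 * exp (9 * d)) * real n powr (- ((1 - 3 / 4 * \<eta>) * h))"
          by (simp add: algebra_simps)
        also have "\<dots> \<le> real n powr (\<eta> / 4 * h) * real n powr (- ((1 - 3 / 4 * \<eta>) * h))"
        proof (intro mult_right_mono)
          have "\<eta> / 4 * 1 \<le> \<eta> / 4 * h" using h1 \<open>\<eta> > 0\<close> by (intro mult_left_mono) auto
          then have "real n powr (\<eta> / 4) \<le> real n powr (\<eta> / 4 * h)" using n1 by (intro powr_mono) auto
          then show "3 + 3 * exp (9 * d) \<le> real n powr (\<eta> / 4 * h)" using D by linarith
        qed auto
        also have "\<dots> = real n powr (- ((1 - \<eta>) * h))" by (simp add: algebra_simps flip: powr_add)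
        finally show ?thesis .
      qed
    qed
    then show "?P (F_event l) \<le> (1 / real n) powr ((1 - \<eta>) * h_exc (real l))"
      using n by (simp add: powr_inverse_nat h_def)
  qed
qed

end
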